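(* For every finite non-spherical set $X$ (in some Euclidean space $\mathbb{E}^d$), there exists a natural number $m$ such that for all $n$ one has $\mathbb{E}^n \nrightarrow (X, \ell_m)$; that is, for every $n$ there is a colouring of the points of $\mathbb{E}^n$ with two colours, red and blue, containing no copy of $X$ all of whose points are red and no copy of $\ell_m$ all of whose points are blue.
   Context: $\mathbb{E}^n$ denotes $n$-dimensional Euclidean space, i.e. $\mathbb{R}^n$ with the Euclidean metric. A copy of a finite set $X$ in $\mathbb{E}^n$ means an isometric copy, i.e. the image of $X$ under a distance-preserving map from $X$ into $\mathbb{E}^n$. A finite set is spherical if it can be embedded in the surface of a sphere of some dimension (i.e. some isometric copy of it lies on a sphere of finite radius in some Euclidean space), and non-spherical otherwise. For a natural number $m$, $\ell_m$ denotes the set consisting of $m$ points on a line with consecutive points at distance one. For finite sets $X_1, X_2$, the notation $\mathbb{E}^n \rightarrow (X_1,X_2)$ means that every $2$-colouring of $\mathbb{E}^n$ contains a copy of $X_i$ in colour $i$ for some $i\in\{1,2\}$, and $\mathbb{E}^n \nrightarrow (X_1,X_2)$ means that some $2$-colouring of $\mathbb{E}^n$ contains no copy of $X_i$ in colour $i$ for either $i$. *)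

theory Defs
  imports "HOL-Analysis.Analysis"
begin

(* The dimension has to be a term, since the theorem quantifies over all dimensions inside an
   existential. Points of n-dimensional Euclidean space are therefore the sequences vanishing
   from index n on, i.e. the points of the library's topology Euclidean_space n. *)

definition E :: "nat \<Rightarrow> (nat \<Rightarrow> real) set" where
  "E n = topspace (Euclidean_space n)"

definition edist :: "nat \<Rightarrow> (nat \<Rightarrow> real) \<Rightarrow> (nat \<Rightarrow> real) \<Rightarrow> real" where
  "edist n x y = L2_set (\<lambda>i. x i - y i) {..<n}"

lemma E_iff: "x \<in> E n \<longleftrightarrow> (\<forall>i\<ge>n. x i = 0)"
  by (simp add: E_def topspace_Euclidean_space)

lemma Metric_space_E: "Metric_space (E n) (edist n)"
proof
  fix x y z
  show "0 \<le> edist n x y"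
    by (simp add: edist_def)
  show "edist n x y = edist n y x"
    by (simp add: edist_def L2_set_def power2_commute)
  show "edist n x y = 0 \<longleftrightarrow> x = y" if "x \<in> E n" "y \<in> E n"
  proof
    assume "edist n x y = 0"
    then have "x i = y i" if "i < n" for i
      using that by (simp add: edist_def L2_set_eq_0_iff)
    moreover have "x i = y i" if "i \<ge> n" for i
      using that \<open>x \<in> E n\<close> \<open>y \<in> E n\<close> by (simp add: E_iff)
    ultimately show "x = y"
      by (meson ext not_le)
  qed (simp add: edist_def L2_set_def)
  show "edist n x z \<le> edist n x y + edist n y z"
    using L2_set_triangle_ineq[of "\<lambda>i. x i - y i" "\<lambda>i. y i - z i" "{..<n}"]
    by (simp add: edist_def)
qed

(* "Y is a copy in n-space of the set X in d-space" *)
definition is_copy :: "nat \<Rightarrow> (nat \<Rightarrow> real) set \<Rightarrow> nat \<Rightarrow> (nat \<Rightarrow> real) set \<Rightarrow> bool" where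
  "is_copy d X n Y \<longleftrightarrow>
     (\<exists>f. f ` X = Y \<and> Y \<subseteq> E n \<and> (\<forall>x\<in>X. \<forall>y\<in>X. edist n (f x) (f y) = edist d x y))"

definition spherical :: "nat \<Rightarrow> (nat \<Rightarrow> real) set \<Rightarrow> bool" where
  "spherical d X \<longleftrightarrow>
     (\<exists>k Y. is_copy d X k Y \<and> (\<exists>c\<in>E k. \<exists>r>0. \<forall>y\<in>Y. edist k c y = r))"

(* A representative of the set of m collinear points in unit steps, located in 1-space *)
definition ell :: "nat \<Rightarrow> (nat \<Rightarrow> real) set" where
  "ell m = {(\<lambda>j. if j = 0 then real i else 0) | i. i < m}"

lemma ell_subset_E: "ell m \<subseteq> E 1"
  by (auto simp: ell_def E_iff)

datatype colour = Red | Blue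

(* A colouring is a total function; only its values on E n matter, as copies lie in E n. *)
definition arrows ::
  "nat \<Rightarrow> nat \<Rightarrow> (nat \<Rightarrow> real) set \<Rightarrow> nat \<Rightarrow> (nat \<Rightarrow> real) set \<Rightarrow> bool" where
  "arrows n d1 X1 d2 X2 \<longleftrightarrow>
     (\<forall>c :: (nat \<Rightarrow> real) \<Rightarrow> colour.
        (\<exists>Y. is_copy d1 X1 n Y \<and> (\<forall>y\<in>Y. c y = Red)) \<or>
        (\<exists>Y. is_copy d2 X2 n Y \<and> (\<forall>y\<in>Y. c y = Blue)))"

end

theory Submission
  imports Defs "HOL-Library.Real_Mod"
begin

text \<open>
  Write \<open>e(u)\<close> for \<open>cis u\<close>. A finite set \<open>X\<close> is non-spherical exactly when the function
  \<open>|x|\<^sup>2\<close> on \<open>X\<close> is not affine, and duality turns this into weights \<open>c\<^sub>x\<close> with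
  \<open>\<Sum> c\<^sub>x = 0\<close>, \<open>\<Sum> c\<^sub>x x = 0\<close> and \<open>b = \<Sum> c\<^sub>x |x|\<^sup>2 \<noteq> 0\<close>
  (\<open>obtain_dependency_if_not_spherical\<close>). These sums can be expressed through distances, so every
  copy \<open>x \<mapsto> f x\<close> of \<open>X\<close>, in any dimension, satisfies the same equation
  \<open>\<Sum> c\<^sub>x |f x|\<^sup>2 = b\<close> (\<open>dependency_isometry_invariant\<close>). The squared distances from the
  origin of the points of a copy of \<open>\<ell>\<^sub>m\<close> are the first \<open>m\<close> values of a polynomial
  \<open>i\<^sup>2 + \<alpha> i + \<beta>\<close> (\<open>sqnorm_unit_progression\<close>). A colouring that depends on \<open>|y|\<^sup>2\<close>
  alone therefore reduces the problem to one about real numbers, from which the dimension has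
  disappeared.

  Fix a dilation \<open>t\<close> and a small \<open>\<eta>\<close>, and let \<open>y\<close> be red if all the numbers
  \<open>t c\<^sub>x |y|\<^sup>2\<close> lie close to \<open>2 \<pi> \<int>\<close>, precisely, \<open>|e(t c\<^sub>x |y|\<^sup>2) - 1| < \<eta>\<close> for
  all \<open>x\<close> in \<open>X\<close>. A red copy of \<open>X\<close> would make \<open>e(t b)\<close>, which is the product of the
  numbers \<open>e(t c\<^sub>x |f x|\<^sup>2)\<close>, closer to \<open>1\<close> than \<open>\<eta> |X|\<close>; so it suffices that
  \<open>e(t b) \<noteq> 1\<close> and \<open>\<eta> = |e(t b) - 1| / |X|\<close>.

  It remains to choose \<open>t\<close> so that every polynomial \<open>i\<^sup>2 + \<alpha> i + \<beta>\<close> takes a red value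
  within a number of steps that does not depend on \<open>\<alpha>\<close> and \<open>\<beta>\<close>
  (\<open>quadratic_returns_to_Bohr_set\<close>). The weights may satisfy rational relations, so the numbers
  \<open>t c\<^sub>x y\<close> need not be independent modulo \<open>2 \<pi>\<close>. For all but countably many \<open>t\<close>,
  however, each nonzero integer combination \<open>\<theta>\<close> of the \<open>t c\<^sub>x\<close> has \<open>e(\<theta>)\<close> of
  infinite order, and then the averages of \<open>e(\<theta> (i\<^sup>2 + \<alpha> i + \<beta>))\<close> tend to zero uniformly in
  \<open>\<alpha>\<close> and \<open>\<beta>\<close> by Weyl differencing (\<open>quadratic_averages_small\<close>). Now take the
  trigonometric polynomial \<open>Q(y) = \<Prod>\<^sub>x ((1 + e(t c\<^sub>x y)) / 2)\<^sup>r\<close>. It has nonnegative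
  coefficients of sum \<open>1\<close>, and at most \<open>(r + 1)\<^sup>k\<close> terms, where \<open>k = |X|\<close>. Hence the
  average of \<open>|Q|\<^sup>2\<close> along a quadratic progression is at least about \<open>(r + 1)\<^sup>-\<^sup>k\<close>
  (\<open>mean_square_trig_sum_ge\<close>), while \<open>|Q|\<^sup>2\<close> is exponentially small in \<open>r\<close> at every
  blue value. For large \<open>r\<close> not all values can be blue.
\<close>

section \<open>The affine dependency of a non-spherical set\<close>

text \<open>
  The Fredholm alternative for finitely many functions on a finite set, by induction on the number of
  functions: a new \<open>g k\<close> either adds no new constraint on the annihilators, or
  some annihilator \<open>c\<close> of the others detects it and fixes its coefficient.
\<close>
lemma in_span_if_annihilated:
  fixes g :: "'j \<Rightarrow> 'x \<Rightarrow> real" and h :: "'x \<Rightarrow> real"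
  assumes "finite J" "finite X"
    and "\<And>c. \<forall>j\<in>J. (\<Sum>x\<in>X. c x * g j x) = 0 \<Longrightarrow> (\<Sum>x\<in>X. c x * h x) = 0"
  shows "\<exists>a. \<forall>x\<in>X. h x = (\<Sum>j\<in>J. a j * g j x)"
  using assms(1,3)
proof (induction J arbitrary: h rule: finite_induct)
  case empty
  have "(\<Sum>x\<in>X. h x * h x) = 0"
    using empty.prems by simp
  then have "\<forall>x\<in>X. h x = 0"
    using \<open>finite X\<close> by (simp add: sum_nonneg_eq_0_iff)
  then show ?case by simp
next
  case (insert k J)
  show ?case
  proof (cases "\<exists>c. (\<forall>j\<in>J. (\<Sum>x\<in>X. c x * g j x) = 0) \<and> (\<Sum>x\<in>X. c x * g k x) \<noteq> 0")
    case False
    then have "(\<Sum>x\<in>X. c x * h x) = 0" if "\<forall>j\<in>J. (\<Sum>x\<in>X. c x * g j x) = 0" for c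
      using that insert.prems[of c] by auto
    then obtain a where a: "\<forall>x\<in>X. h x = (\<Sum>j\<in>J. a j * g j x)"
      using insert.IH by blast
    have "(\<Sum>j\<in>J. (a(k := 0)) j * g j x) = (\<Sum>j\<in>J. a j * g j x)" for x
      using insert.hyps(2) by (intro sum.cong) auto
    then show ?thesis
      using a insert.hyps by (intro exI[of _ "a(k := 0)"]) simp
  next
    case True
    then obtain c where c: "\<forall>j\<in>J. (\<Sum>x\<in>X. c x * g j x) = 0"
      and ck: "(\<Sum>x\<in>X. c x * g k x) \<noteq> 0"
      by blast
    \<comment> \<open>The coefficient of \<open>g k\<close> is the one for which \<open>c\<close> annihilates the remainder of \<open>h\<close>.\<close>
    define s where "s = (\<Sum>x\<in>X. c x * h x) / (\<Sum>x\<in>X. c x * g k x)"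
    have "(\<Sum>x\<in>X. e x * (h x - s * g k x)) = 0"
      if e: "\<forall>j\<in>J. (\<Sum>x\<in>X. e x * g j x) = 0" for e
    proof -
      define t where "t = (\<Sum>x\<in>X. e x * g k x) / (\<Sum>x\<in>X. c x * g k x)"
      have lin: "(\<Sum>x\<in>X. (e x - t * c x) * f x) = (\<Sum>x\<in>X. e x * f x) - t * (\<Sum>x\<in>X. c x * f x)" for f
        by (simp add: algebra_simps sum_subtractf sum_distrib_left)
      have "(\<Sum>x\<in>X. (e x - t * c x) * h x) = 0"
      proof (rule insert.prems, rule ballI)
        fix j assume "j \<in> insert k J"
        then show "(\<Sum>x\<in>X. (e x - t * c x) * g j x) = 0"
          unfolding lin using c e ck by (auto simp: t_def)
      qed
      then have "(\<Sum>x\<in>X. e x * h x) = t * (\<Sum>x\<in>X. c x * h x)"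
        unfolding lin by simp
      also have "\<dots> = s * (\<Sum>x\<in>X. e x * g k x)"
        by (simp add: s_def t_def)
      finally show ?thesis
        by (simp add: algebra_simps sum_subtractf sum_distrib_left)
    qed
    then obtain a where a: "\<forall>x\<in>X. h x - s * g k x = (\<Sum>j\<in>J. a j * g j x)"
      using insert.IH[of "\<lambda>x. h x - s * g k x"] by blast
    have "(\<Sum>j\<in>J. (a(k := s)) j * g j x) = (\<Sum>j\<in>J. a j * g j x)" for x
      using insert.hyps(2) by (intro sum.cong) auto
    then show ?thesis
      using a insert.hyps by (intro exI[of _ "a(k := s)"]) (simp add: algebra_simps)
  qed
qed

definition sqnorm :: "nat \<Rightarrow> (nat \<Rightarrow> real) \<Rightarrow> real" where
  "sqnorm n x = (\<Sum>i<n. (x i)\<^sup>2)"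

lemma edist_squared: "(edist n x y)\<^sup>2 = (\<Sum>i<n. (x i - y i)\<^sup>2)"
  by (simp add: edist_def L2_set_def sum_nonneg)

text \<open>
  The definition of a spherical set asks for a positive radius, which the common distance from
  \<open>p\<close> fails to provide when \<open>X\<close> is the single point \<open>p\<close>.
\<close>
lemma spherical_if_equidistant:
  assumes "X \<subseteq> E d" and "\<And>x. x \<in> X \<Longrightarrow> (\<Sum>i<d. (p i - x i)\<^sup>2) = s"
  shows "spherical d X"
proof -
  have XE: "\<forall>x\<in>X. \<forall>i\<ge>d. x i = 0"
    using assms(1) by (auto simp: E_iff)
  have "is_copy d X (Suc d) X"
    unfolding is_copy_def
  proof (intro exI[of _ id] conjI ballI)
    show "X \<subseteq> E (Suc d)"
      using XE by (auto simp: E_iff)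
    fix x y assume "x \<in> X" "y \<in> X"
    then have "x d = 0" "y d = 0"
      using XE by auto
    then show "edist (Suc d) (id x) (id y) = edist d x y"
      by (simp add: edist_def L2_set_def)
  qed simp
  \<comment> \<open>Moving the centre one unit into an additional dimension makes the radius positive.\<close>
  define c where "c = (\<lambda>i. if i < d then p i else if i = d then 1 else 0)"
  define r where "r = sqrt (\<bar>s\<bar> + 1)"
  have "edist (Suc d) c x = r" if "x \<in> X" for x
  proof -
    have "x d = 0"
      using XE that by blast
    then have "(\<Sum>i<Suc d. (c i - x i)\<^sup>2) = (\<Sum>i<d. (p i - x i)\<^sup>2) + 1"
      by (simp add: c_def)
    moreover have "s \<ge> 0"
      unfolding assms(2)[OF that, symmetric] by (simp add: sum_nonneg)
    ultimately show ?thesis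
      using assms(2)[OF that] by (simp add: edist_def L2_set_def r_def del: sum.lessThan_Suc)
  qed
  moreover have "c \<in> E (Suc d)" "r > 0"
    by (auto simp: c_def E_iff r_def intro!: add_nonneg_pos)
  ultimately show ?thesis
    unfolding spherical_def using \<open>is_copy d X (Suc d) X\<close> by blast
qed

text \<open>
  If every affine dependency of \<open>X\<close> annihilated \<open>|x|\<^sup>2\<close>, then \<open>|x|\<^sup>2\<close> would agree on
  \<open>X\<close> with some \<open>a \<bullet> x + a\<^sub>d\<close>, and completing the square would put \<open>X\<close> on a sphere with
  centre \<open>a / 2\<close>.
\<close>
lemma obtain_dependency_if_not_spherical:
  assumes "X \<subseteq> E d" "finite X" "\<not> spherical d X"
  obtains c where "(\<Sum>x\<in>X. c x) = 0" "\<And>i. i < d \<Longrightarrow> (\<Sum>x\<in>X. c x * x i) = 0"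
    "(\<Sum>x\<in>X. c x * sqnorm d x) \<noteq> 0"
proof (rule ccontr)
  assume neg: "\<not> thesis"
  note dependency = that
  \<comment> \<open>Coordinates and the constant function together, the latter at index \<open>d\<close>.\<close>
  define g :: "nat \<Rightarrow> (nat \<Rightarrow> real) \<Rightarrow> real" where "g = (\<lambda>i x. if i < d then x i else 1)"
  have "(\<Sum>x\<in>X. c x * sqnorm d x) = 0" if c: "\<forall>j\<in>{..d}. (\<Sum>x\<in>X. c x * g j x) = 0" for c
  proof (rule ccontr)
    assume "(\<Sum>x\<in>X. c x * sqnorm d x) \<noteq> 0"
    moreover have "(\<Sum>x\<in>X. c x) = 0"
      using c[rule_format, of d] by (simp add: g_def)
    moreover have "(\<Sum>x\<in>X. c x * x i) = 0" if "i < d" for i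
      using c[rule_format, of i] that by (simp add: g_def)
    ultimately show False
      using neg dependency[of c] by blast
  qed
  then obtain a where a: "\<forall>x\<in>X. sqnorm d x = (\<Sum>j\<in>{..d}. a j * g j x)"
    using in_span_if_annihilated[of "{..d}" X g "sqnorm d"] assms(2) by blast
  have "(\<Sum>i<d. (a i / 2 - x i)\<^sup>2) = a d + (\<Sum>i<d. (a i / 2)\<^sup>2)" if "x \<in> X" for x
  proof -
    have "(\<Sum>j\<in>{..d}. a j * g j x) = (\<Sum>i<d. a i * x i) + a d"
      by (simp add: g_def lessThan_Suc_atMost[symmetric])
    then have "(\<Sum>i<d. (x i)\<^sup>2) = (\<Sum>i<d. a i * x i) + a d"
      using a that by (simp add: sqnorm_def)
    then show ?thesis
      by (simp add: power2_diff sum.distrib sum_subtractf)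
  qed
  then have "spherical d X"
    by (rule spherical_if_equidistant[OF assms(1)])
  then show False
    using assms(3) by simp
qed

section \<open>Squared norms along isometric copies\<close>

text \<open>
  The left-hand side is determined by distances, so for weights of sum zero it is an isometry invariant
  whether \<open>\<Sum> c x * f x\<close> vanishes.
\<close>
lemma weighted_sum_squared_distances:
  assumes "(\<Sum>x\<in>X. c x) = 0"
  shows "(\<Sum>x\<in>X. \<Sum>y\<in>X. c x * c y * (edist n (f x) (f y))\<^sup>2)
           = - 2 * (\<Sum>i<n. (\<Sum>x\<in>X. c x * f x i)\<^sup>2)"
proof -
  have one: "(\<Sum>x\<in>X. \<Sum>y\<in>X. c x * c y * (u x - u y)\<^sup>2) = - 2 * (\<Sum>x\<in>X. c x * u x)\<^sup>2" for u :: "_ \<Rightarrow> real"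
  proof -
    have "(\<Sum>x\<in>X. \<Sum>y\<in>X. c x * c y * (u x - u y)\<^sup>2)
        = (\<Sum>x\<in>X. \<Sum>y\<in>X. (c x * (u x)\<^sup>2) * c y) + (\<Sum>x\<in>X. \<Sum>y\<in>X. c x * (c y * (u y)\<^sup>2))
          - 2 * (\<Sum>x\<in>X. \<Sum>y\<in>X. (c x * u x) * (c y * u y))"
      by (simp add: power2_diff algebra_simps sum.distrib sum_subtractf sum_distrib_left)
    then show ?thesis
      using assms by (simp add: sum_product[symmetric] power2_eq_square)
  qed
  have "(\<Sum>x\<in>X. \<Sum>y\<in>X. c x * c y * (edist n (f x) (f y))\<^sup>2)
      = (\<Sum>x\<in>X. \<Sum>y\<in>X. \<Sum>i<n. c x * c y * (f x i - f y i)\<^sup>2)"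
    by (simp add: edist_squared sum_distrib_left)
  also have "\<dots> = (\<Sum>x\<in>X. \<Sum>i<n. \<Sum>y\<in>X. c x * c y * (f x i - f y i)\<^sup>2)"
    by (intro sum.cong refl) (rule sum.swap)
  also have "\<dots> = (\<Sum>i<n. \<Sum>x\<in>X. \<Sum>y\<in>X. c x * c y * (f x i - f y i)\<^sup>2)"
    by (rule sum.swap)
  finally show ?thesis
    by (simp add: one sum_distrib_left)
qed

lemma weighted_sum_sqnorm:
  assumes "(\<Sum>x\<in>X. c x) = 0" "\<And>i. i < n \<Longrightarrow> (\<Sum>x\<in>X. c x * f x i) = 0"
  shows "(\<Sum>x\<in>X. c x * (edist n (f x) z)\<^sup>2) = (\<Sum>x\<in>X. c x * sqnorm n (f x))"
proof -
  have "(\<Sum>x\<in>X. c x * (edist n (f x) z)\<^sup>2)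
      = (\<Sum>x\<in>X. c x * sqnorm n (f x) - 2 * (\<Sum>i<n. z i * (c x * f x i)) + c x * sqnorm n z)"
    by (intro sum.cong refl)
       (simp add: edist_squared sqnorm_def power2_diff sum.distrib sum_subtractf sum_distrib_left
          algebra_simps)
  also have "\<dots> = (\<Sum>x\<in>X. c x * sqnorm n (f x)) - 2 * (\<Sum>x\<in>X. \<Sum>i<n. z i * (c x * f x i))
                  + (\<Sum>x\<in>X. c x) * sqnorm n z"
    by (simp add: sum.distrib sum_subtractf sum_distrib_left sum_distrib_right)
  also have "(\<Sum>x\<in>X. \<Sum>i<n. z i * (c x * f x i)) = (\<Sum>i<n. z i * (\<Sum>x\<in>X. c x * f x i))"
    unfolding sum_distrib_left by (rule sum.swap)
  finally show ?thesis
    using assms by simp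
qed

text \<open>
  The double sum of weighted squared distances carries \<open>\<Sum> c x * x = 0\<close> over to the image;
  then both sides equal the same weighted sum of squared distances from one point of the set.
\<close>
lemma dependency_isometry_invariant:
  assumes c: "(\<Sum>x\<in>X. c x) = 0" "\<And>i. i < d \<Longrightarrow> (\<Sum>x\<in>X. c x * x i) = 0"
    and iso: "\<And>x y. x \<in> X \<Longrightarrow> y \<in> X \<Longrightarrow> edist n (f x) (f y) = edist d x y"
  shows "(\<Sum>x\<in>X. c x * sqnorm n (f x)) = (\<Sum>x\<in>X. c x * sqnorm d x)"
proof (cases "X = {}")
  case False
  then obtain z where z: "z \<in> X" by blast
  have "(\<Sum>i<n. (\<Sum>x\<in>X. c x * f x i)\<^sup>2) = (\<Sum>i<d. (\<Sum>x\<in>X. c x * x i)\<^sup>2)"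
    using weighted_sum_squared_distances[OF c(1), of n f]
      weighted_sum_squared_distances[OF c(1), of d "\<lambda>x. x"] iso by simp
  then have "(\<Sum>i<n. (\<Sum>x\<in>X. c x * f x i)\<^sup>2) = 0"
    using c(2) by simp
  then have cf: "\<And>i. i < n \<Longrightarrow> (\<Sum>x\<in>X. c x * f x i) = 0"
    by (simp add: sum_nonneg_eq_0_iff)
  show ?thesis
    using weighted_sum_sqnorm[of c X n f "f z", OF c(1) cf]
      weighted_sum_sqnorm[of c X d "\<lambda>x. x" z, OF c] iso z by simp
qed simp

text \<open>
  Unit distances make \<open>p\<close> an affine progression, by the equality case of Cauchy-Schwarz for the
  displacement \<open>p i - p 0\<close> and the unit vector \<open>p 1 - p 0\<close>; the leading coefficient is the squared
  length of the step.
\<close>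
lemma sqnorm_unit_progression:
  assumes iso: "\<And>i j. i < m \<Longrightarrow> j < m \<Longrightarrow> edist n (p i) (p j) = \<bar>real i - real j\<bar>"
    and "m \<ge> 2"
  obtains a b where "\<And>i. i < m \<Longrightarrow> sqnorm n (p i) = (real i)\<^sup>2 + a * real i + b"
proof
  define u where "u = (\<lambda>l. p 1 l - p 0 l)"
  have iso2: "(\<Sum>l<n. (p i l - p j l)\<^sup>2) = (real i - real j)\<^sup>2" if "i < m" "j < m" for i j
    using iso[OF that] by (simp flip: edist_squared)
  have uu: "(\<Sum>l<n. (u l)\<^sup>2) = 1"
    using iso2[of 1 0] \<open>m \<ge> 2\<close> by (simp add: u_def)
  fix i assume "i < m"
  define w where "w = (\<lambda>l. p i l - p 0 l)"
  have ww: "(\<Sum>l<n. (w l)\<^sup>2) = (real i)\<^sup>2"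
    using iso2[of i 0] \<open>i < m\<close> by (simp add: w_def)
  have "(\<Sum>l<n. (w l - u l)\<^sup>2) = (real i - 1)\<^sup>2"
    using iso2[of i 1] \<open>i < m\<close> \<open>m \<ge> 2\<close> by (simp add: w_def u_def)
  then have wu: "(\<Sum>l<n. w l * u l) = real i"
    using uu ww by (simp add: power2_diff sum.distrib sum_subtractf mult.assoc flip: sum_distrib_left)
  \<comment> \<open>Since \<open>w \<bullet> u = |w| |u|\<close>, the vector \<open>w\<close> is the multiple \<open>i u\<close>.\<close>
  have "(\<Sum>l<n. (w l - i * u l)\<^sup>2)
      = (\<Sum>l<n. (w l)\<^sup>2) - 2 * i * (\<Sum>l<n. w l * u l) + i\<^sup>2 * (\<Sum>l<n. (u l)\<^sup>2)"
    by (simp add: power2_diff power_mult_distrib sum.distrib sum_subtractf sum_distrib_left algebra_simps)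
  then have "(\<Sum>l<n. (w l - i * u l)\<^sup>2) = 0"
    unfolding uu ww wu by (simp add: power2_eq_square)
  then have "w l - i * u l = 0" if "l < n" for l
    using that by (simp add: sum_nonneg_eq_0_iff)
  then have "p i l = p 0 l + i * u l" if "l < n" for l
    using that unfolding w_def by force
  then have "sqnorm n (p i) = (\<Sum>l<n. (p 0 l + i * u l)\<^sup>2)"
    by (simp add: sqnorm_def)
  also have "\<dots> = i\<^sup>2 * (\<Sum>l<n. (u l)\<^sup>2) + 2 * (\<Sum>l<n. p 0 l * u l) * i + sqnorm n (p 0)"
    by (simp add: sqnorm_def power2_sum power_mult_distrib sum.distrib sum_distrib_left algebra_simps)
  finally show "sqnorm n (p i) = (real i)\<^sup>2 + 2 * (\<Sum>l<n. p 0 l * u l) * real i + sqnorm n (p 0)"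
    by (simp add: uu)
qed

section \<open>Phases of infinite order\<close>

text \<open>
  The condition says that \<open>\<theta> / \<pi>\<close> is irrational, in the form used for exponential sums: \<open>cis \<theta>\<close>
  has infinite order in the circle group.
\<close>
definition nontorsion :: "real \<Rightarrow> bool" where
  "nontorsion \<theta> \<longleftrightarrow> (\<forall>h::nat. h > 0 \<longrightarrow> cis (real h * \<theta>) \<noteq> 1)"

lemma nontorsion_int_multiple:
  assumes "nontorsion \<theta>" "k \<noteq> 0"
  shows "cis (of_int k * \<theta>) \<noteq> 1"
proof (cases "k > 0")
  case True
  then show ?thesis
    using assms(1) unfolding nontorsion_def by (metis zero_less_nat_eq of_nat_nat less_imp_le)
next
  case False
  then have "nat (- k) > 0"
    using assms(2) by simp
  then have "cis (real (nat (- k)) * \<theta>) \<noteq> 1"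
    using assms(1) unfolding nontorsion_def by blast
  then have "cis (- (of_int k * \<theta>)) \<noteq> 1"
    using False by simp
  then show ?thesis
    by (metis cis_inverse inverse_1)
qed

text \<open>
  For fixed \<open>l\<close> and \<open>h\<close>, only the countably many \<open>t\<close> in
  \<open>2 \<pi> \<int> / (h l)\<close> violate \<open>cis (h t l) \<noteq> 1\<close>.
\<close>
lemma generic_dilation:
  fixes L :: "real set"
  assumes "countable L"
  obtains t where "\<And>l. l \<in> L \<Longrightarrow> l \<noteq> 0 \<Longrightarrow> nontorsion (t * l)"
proof -
  define B where "B = (\<lambda>(l, h, n). of_int n * (2 * pi) / (real h * l)) ` (L \<times> (UNIV :: nat set) \<times> (UNIV :: int set))"
  have "countable B"
    unfolding B_def using assms by (intro countable_image countable_SIGMA) auto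
  then obtain t where t: "t \<notin> B"
    using uncountable_UNIV_real by (metis UNIV_eq_I)
  show thesis
  proof
    fix l assume l: "l \<in> L" "l \<noteq> 0"
    show "nontorsion (t * l)"
      unfolding nontorsion_def
    proof (intro allI impI notI)
      fix h :: nat assume "h > 0" "cis (real h * (t * l)) = 1"
      then obtain n where "real h * (t * l) = of_int n * (2 * pi)"
        unfolding cis_eq_1_iff by blast
      then have "t = of_int n * (2 * pi) / (real h * l)"
        using \<open>h > 0\<close> l by (simp add: field_simps)
      then have "t \<in> B"
        unfolding B_def using l by (intro image_eqI[of _ _ "(l, h, n)"]) auto
      with t show False ..
    qed
  qed
qed

text \<open>
  One dilation handles all integer combinations at once, as there are only countably many of them. It
  leaves the relations among the \<open>c j\<close> intact: combinations that vanish still vanish.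
\<close>
lemma generic_dilation_of_integer_combinations:
  fixes c :: "'j \<Rightarrow> real"
  assumes "finite J" "b \<noteq> 0"
  obtains t where "nontorsion (t * b)"
    "\<And>n :: 'j \<Rightarrow> int. (\<Sum>j\<in>J. of_int (n j) * (t * c j)) \<noteq> 0 \<Longrightarrow>
       nontorsion (\<Sum>j\<in>J. of_int (n j) * (t * c j))"
proof -
  define comb where "comb = (\<lambda>n :: 'j \<Rightarrow> int. \<Sum>j\<in>J. of_int (n j) * c j)"
  have "countable (insert b (comb ` PiE J (\<lambda>_. UNIV)))"
    using assms(1) by (intro countable_insert countable_image countable_PiE) auto
  then obtain t where t: "\<And>l. l \<in> insert b (comb ` PiE J (\<lambda>_. UNIV)) \<Longrightarrow> l \<noteq> 0 \<Longrightarrow> nontorsion (t * l)"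
    using generic_dilation by blast
  show thesis
  proof
    show "nontorsion (t * b)"
      using t[of b] assms(2) by simp
  next
    fix n :: "'j \<Rightarrow> int"
    have "(\<Sum>j\<in>J. of_int (n j) * (t * c j)) = t * comb (restrict n J)"
      by (simp add: comb_def sum_distrib_left algebra_simps)
    moreover have "comb (restrict n J) \<in> insert b (comb ` PiE J (\<lambda>_. UNIV))"
      by auto
    moreover assume "(\<Sum>j\<in>J. of_int (n j) * (t * c j)) \<noteq> 0"
    ultimately show "nontorsion (\<Sum>j\<in>J. of_int (n j) * (t * c j))"
      using t by force
  qed
qed

section \<open>Uniform smallness of quadratic exponential sums\<close>

lemma norm_geometric_sum_le:
  fixes z :: complex
  assumes "norm z = 1" "z \<noteq> 1"
  shows "norm (\<Sum>x<M. z ^ x) \<le> 2 / norm (z - 1)"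
proof -
  have "norm (\<Sum>x<M. z ^ x) = norm (z ^ M - 1) / norm (z - 1)"
    using assms by (simp add: geometric_sum norm_divide)
  also have "norm (z ^ M - 1) \<le> 2"
    using norm_triangle_ineq4[of "z ^ M" 1] assms(1) by (simp add: norm_power)
  then have "norm (z ^ M - 1) / norm (z - 1) \<le> 2 / norm (z - 1)"
    by (simp add: divide_right_mono)
  finally show ?thesis .
qed

text \<open>
  Cauchy-Schwarz in the outer variable, followed by expansion of the inner square: the van der Corput
  inequality in a form free of boundary terms.
\<close>
lemma norm_double_sum_squared_le:
  fixes u :: "nat \<Rightarrow> nat \<Rightarrow> complex"
  shows "(norm (\<Sum>x<M. \<Sum>y<H. u x y))\<^sup>2
           \<le> real M * (\<Sum>y<H. \<Sum>y'<H. norm (\<Sum>x<M. u x y * cnj (u x y')))"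
proof -
  have "(norm (\<Sum>x<M. \<Sum>y<H. u x y))\<^sup>2 \<le> (\<Sum>x<M. norm (\<Sum>y<H. u x y))\<^sup>2"
    by (intro power_mono norm_sum) auto
  also have "\<dots> \<le> (\<Sum>x<M. (norm (\<Sum>y<H. u x y))\<^sup>2) * real M"
    using sum_squared_le_sum_of_squares[of "\<lambda>x. norm (\<Sum>y<H. u x y)" "{..<M}"] by simp
  also have "(\<Sum>x<M. (norm (\<Sum>y<H. u x y))\<^sup>2) = Re (\<Sum>x<M. \<Sum>y<H. \<Sum>y'<H. u x y * cnj (u x y'))"
    by (simp add: cmod_power2 complex_norm_square[symmetric] sum_product[symmetric] 
      flip: cnj_sum complex_norm_square)
  also have "(\<Sum>x<M. \<Sum>y<H. \<Sum>y'<H. u x y * cnj (u x y'))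
      = (\<Sum>y<H. \<Sum>y'<H. \<Sum>x<M. u x y * cnj (u x y'))"
    by (simp only: sum.swap[of _ _ "{..<M}"])
  also have "Re \<dots> \<le> norm \<dots>"
    by (rule complex_Re_le_cmod)
  also have "\<dots> \<le> (\<Sum>y<H. \<Sum>y'<H. norm (\<Sum>x<M. u x y * cnj (u x y')))"
    by (rule order_trans[OF norm_sum]) (intro sum_mono norm_sum)
  finally show ?thesis
    by (simp add: mult.commute mult_right_mono)
qed

text \<open>
  Weyl differencing for the average over \<open>i = x + y\<close>, with a long variable \<open>x\<close> and a short variable
  \<open>y\<close>. Averaging over these sums instead of an interval gives exact identities; the unequal weights that it
  puts on \<open>i\<close> do no harm, as the averages only serve to find one good \<open>i\<close>. What matters is that
  \<open>M\<close> and \<open>H\<close> do not depend on \<open>a\<close> and \<open>b\<close>.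
\<close>
lemma quadratic_averages_small:
  fixes L :: "real set"
  assumes "finite L" "\<And>\<theta>. \<theta> \<in> L \<Longrightarrow> nontorsion \<theta>" "\<epsilon> > 0"
  obtains M H :: nat where "M > 0" "H > 0"
    "\<And>\<theta> a b. \<theta> \<in> L \<Longrightarrow>
       norm (\<Sum>x<M. \<Sum>y<H. cis (\<theta> * ((real (x + y))\<^sup>2 + a * real (x + y) + b))) \<le> \<epsilon> * (real M * real H)"
proof -
  \<comment> \<open>The diagonal \<open>y = y'\<close> contributes a proportion \<open>1 / H\<close> whatever \<open>M\<close> is. The other pairs
    contribute geometric sums bounded by some \<open>C\<close> that depends on \<open>H\<close>, so \<open>M\<close> is chosen last.\<close>
  obtain H :: nat where H: "real H > 2 / \<epsilon>\<^sup>2"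
    using reals_Archimedean2 by blast
  have "0 < 2 / \<epsilon>\<^sup>2"
    using \<open>\<epsilon> > 0\<close> by simp
  then have "H > 0"
    using H by (cases H) auto
  define z where "z = (\<lambda>\<theta> y y'. cis (of_int (2 * (int y - int y')) * \<theta>))"
  define C where "C = (\<Sum>\<theta>\<in>L. \<Sum>y<H. \<Sum>y'<H. 2 / norm (z \<theta> y y' - 1))"
  have "C \<ge> 0"
    unfolding C_def by (intro sum_nonneg) auto
  obtain M' :: nat where M': "real M' > 2 * C / \<epsilon>\<^sup>2"
    using reals_Archimedean2 by blast
  define M where "M = Suc M'"
  have M: "M > 0" "real M \<ge> 2 * C / \<epsilon>\<^sup>2"
    using M' by (auto simp: M_def)
  show thesis
  proof
    fix \<theta> a b assume "\<theta> \<in> L"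
    define u where "u = (\<lambda>x y. cis (\<theta> * ((real (x + y))\<^sup>2 + a * real (x + y) + b)))"
    \<comment> \<open>Differencing in \<open>y\<close> turns the quadratic phase into a linear one: \<open>b\<close> cancels, and \<open>a\<close>
      survives only in a factor independent of \<open>x\<close>.\<close>
    have diff: "u x y * cnj (u x y')
        = cis (\<theta> * ((real y)\<^sup>2 - (real y')\<^sup>2 + a * (real y - real y'))) * z \<theta> y y' ^ x" for x y y'
      unfolding u_def z_def cis_cnj cis_mult Complex.DeMoivre
      by (rule arg_cong[of _ _ cis]) (simp add: power2_eq_square algebra_simps)
    have inner: "norm (\<Sum>x<M. u x y * cnj (u x y')) = norm (\<Sum>x<M. z \<theta> y y' ^ x)" for y y'
      unfolding diff by (simp add: norm_mult flip: sum_distrib_left)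
    have diag: "norm (\<Sum>x<M. u x y * cnj (u x y)) = real M" for y
      unfolding inner by (simp add: z_def)
    have C: "norm (\<Sum>x<M. u x y * cnj (u x y')) \<le> C" if "y < H" "y' < H" "y \<noteq> y'" for y y'
    proof -
      have "z \<theta> y y' \<noteq> 1"
        unfolding z_def using \<open>y \<noteq> y'\<close>
        by (intro nontorsion_int_multiple[OF assms(2)[OF \<open>\<theta> \<in> L\<close>]]) auto
      then have "norm (\<Sum>x<M. z \<theta> y y' ^ x) \<le> 2 / norm (z \<theta> y y' - 1)"
        by (intro norm_geometric_sum_le) (simp_all add: z_def)
      also have "\<dots> \<le> (\<Sum>y'<H. 2 / norm (z \<theta> y y' - 1))"
        using that by (intro member_le_sum) auto
      also have "\<dots> \<le> (\<Sum>y<H. \<Sum>y'<H. 2 / norm (z \<theta> y y' - 1))"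
        using that by (intro member_le_sum[of y _ "\<lambda>y. \<Sum>y'<H. 2 / norm (z \<theta> y y' - 1)"] sum_nonneg) auto
      also have "\<dots> \<le> C"
        unfolding C_def using \<open>\<theta> \<in> L\<close> \<open>finite L\<close>
        by (intro member_le_sum[of \<theta> _ "\<lambda>\<theta>. \<Sum>y<H. \<Sum>y'<H. 2 / norm (z \<theta> y y' - 1)"] sum_nonneg) auto
      finally show ?thesis
        unfolding inner .
    qed
    have "(\<Sum>y<H. \<Sum>y'<H. norm (\<Sum>x<M. u x y * cnj (u x y')))
        \<le> (\<Sum>y<H. \<Sum>y'<H. (if y = y' then real M else 0) + C)"
      using C diag \<open>C \<ge> 0\<close> by (intro sum_mono) auto
    also have "\<dots> = real H * real M + (real H)\<^sup>2 * C"
      by (simp add: sum.distrib power2_eq_square algebra_simps)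
    finally have "(norm (\<Sum>x<M. \<Sum>y<H. u x y))\<^sup>2 \<le> real M * (real H * real M + (real H)\<^sup>2 * C)"
      using norm_double_sum_squared_le[where u = u and M = M and H = H] by (smt (verit) mult_left_mono of_nat_0_le_iff)
    also have "\<dots> \<le> real M * (real H * (real H * \<epsilon>\<^sup>2 / 2) * real M + (real H)\<^sup>2 * (real M * \<epsilon>\<^sup>2 / 2))"
    proof (intro mult_left_mono add_mono)
      have H_large: "1 \<le> real H * \<epsilon>\<^sup>2 / 2"
        using H \<open>\<epsilon> > 0\<close> by (simp add: field_simps)
      show "real H * real M \<le> real H * (real H * \<epsilon>\<^sup>2 / 2) * real M"
        using mult_right_mono[OF mult_left_mono[OF H_large, of "real H"], of "real M"] by simp
      show "C \<le> real M * \<epsilon>\<^sup>2 / 2"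
        using M(2) \<open>\<epsilon> > 0\<close> by (simp add: field_simps)
    qed auto
    also have "\<dots> = (\<epsilon> * (real M * real H))\<^sup>2"
      by (simp add: power2_eq_square field_simps)
    finally show "norm (\<Sum>x<M. \<Sum>y<H. u x y) \<le> \<epsilon> * (real M * real H)"
      using \<open>\<epsilon> > 0\<close> by (simp add: power2_le_iff_abs_le)
  qed fact+
qed

section \<open>Returns of quadratic progressions to Bohr sets\<close>

text \<open>
  Expanding the square, pairs with equal frequencies contribute fully and all others almost nothing.
  Different \<open>f\<close> may share a frequency, but with nonnegative coefficients such coincidences only
  increase the mean; the pairs \<open>f = g\<close> already give \<open>\<Sum> (q f)\<^sup>2 \<ge> 1 / card \<Phi>\<close>.
\<close>
lemma mean_square_trig_sum_ge:
  fixes q s :: "'f \<Rightarrow> real" and Y :: "'p \<Rightarrow> real" and \<epsilon> :: real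
  assumes fin: "finite \<Phi>" "finite P"
    and q: "\<And>f. f \<in> \<Phi> \<Longrightarrow> q f \<ge> 0" "(\<Sum>f\<in>\<Phi>. q f) = 1"
    and small: "\<And>f g. f \<in> \<Phi> \<Longrightarrow> g \<in> \<Phi> \<Longrightarrow> s f \<noteq> s g \<Longrightarrow>
      norm (\<Sum>p\<in>P. cis ((s f - s g) * Y p)) \<le> \<epsilon> * card P"
    and "\<epsilon> \<ge> 0"
  shows "(\<Sum>p\<in>P. (norm (\<Sum>f\<in>\<Phi>. of_real (q f) * cis (s f * Y p)))\<^sup>2)
           \<ge> (1 / card \<Phi> - \<epsilon>) * card P"
proof -
  have "\<Phi> \<noteq> {}"
    using q(2) by auto
  then have card: "card \<Phi> > 0"
    using fin(1) by (simp add: card_gt_0_iff)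
  define w where "w = (\<lambda>f g. \<Sum>p\<in>P. cis ((s f - s g) * Y p))"
  have w: "Re (w f g) \<ge> (if f = g then real (card P) else 0) - \<epsilon> * card P"
    if "f \<in> \<Phi>" "g \<in> \<Phi>" for f g
  proof (cases "s f = s g")
    case True
    moreover have "\<epsilon> * card P \<ge> 0"
      using \<open>\<epsilon> \<ge> 0\<close> by simp
    ultimately show ?thesis
      by (simp add: w_def)
  next
    case False
    then have "norm (w f g) \<le> \<epsilon> * card P"
      unfolding w_def using small that by blast
    then show ?thesis
      using abs_Re_le_cmod[of "w f g"] False by auto
  qed
  have "(\<Sum>p\<in>P. (norm (\<Sum>f\<in>\<Phi>. of_real (q f) * cis (s f * Y p)))\<^sup>2)
      = Re (\<Sum>p\<in>P. \<Sum>f\<in>\<Phi>. \<Sum>g\<in>\<Phi>. of_real (q f * q g) * cis ((s f - s g) * Y p))"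
  proof -
    have split: "cis ((s f - s g) * Y p) = cis (s f * Y p) * cnj (cis (s g * Y p))" for f g p
      by (simp add: cis_cnj cis_mult left_diff_distrib)
    have square: "of_real ((norm (\<Sum>f\<in>\<Phi>. of_real (q f) * cis (s f * Y p)))\<^sup>2)
        = (\<Sum>f\<in>\<Phi>. \<Sum>g\<in>\<Phi>. of_real (q f * q g) * cis ((s f - s g) * Y p))" for p
      unfolding complex_norm_square cnj_sum sum_product
      by (intro sum.cong refl) (simp add: split)
    have "(norm (\<Sum>f\<in>\<Phi>. of_real (q f) * cis (s f * Y p)))\<^sup>2
        = Re (\<Sum>f\<in>\<Phi>. \<Sum>g\<in>\<Phi>. of_real (q f * q g) * cis ((s f - s g) * Y p))" for p
      using arg_cong[OF square[of p], of Re] by (simp only: Re_complex_of_real)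
    then show ?thesis
      by (simp only: Re_sum)
  qed
  also have "(\<Sum>p\<in>P. \<Sum>f\<in>\<Phi>. \<Sum>g\<in>\<Phi>. of_real (q f * q g) * cis ((s f - s g) * Y p))
      = (\<Sum>f\<in>\<Phi>. \<Sum>g\<in>\<Phi>. of_real (q f * q g) * w f g)"
    unfolding w_def sum_distrib_left by (simp only: sum.swap[of _ _ P])
  also have "Re \<dots> = (\<Sum>f\<in>\<Phi>. \<Sum>g\<in>\<Phi>. q f * q g * Re (w f g))"
    by simp
  also have "\<dots> \<ge> (\<Sum>f\<in>\<Phi>. \<Sum>g\<in>\<Phi>. q f * q g * ((if f = g then real (card P) else 0) - \<epsilon> * card P))"
    by (intro sum_mono mult_left_mono w mult_nonneg_nonneg q(1))
  also have "(\<Sum>f\<in>\<Phi>. \<Sum>g\<in>\<Phi>. q f * q g * ((if f = g then real (card P) else 0) - \<epsilon> * card P))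
      = (\<Sum>f\<in>\<Phi>. (q f)\<^sup>2) * card P - (\<Sum>f\<in>\<Phi>. \<Sum>g\<in>\<Phi>. q f * q g) * (\<epsilon> * card P)"
  proof -
    have "(\<Sum>g\<in>\<Phi>. q f * q g * ((if f = g then real (card P) else 0) - \<epsilon> * card P))
        = (q f)\<^sup>2 * card P - (\<Sum>g\<in>\<Phi>. q f * q g) * (\<epsilon> * card P)" if "f \<in> \<Phi>" for f
    proof -
      have "(\<Sum>g\<in>\<Phi>. q f * q g * ((if f = g then real (card P) else 0) - \<epsilon> * card P))
        = (\<Sum>g\<in>\<Phi>. (if f = g then q f * q g * real (card P) else 0) - q f * q g * (\<epsilon> * card P))"
        by (intro sum.cong) (auto simp: algebra_simps)
      then show ?thesis
        using that fin(1) by (simp add: sum_subtractf sum_distrib_right power2_eq_square)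
    qed
    then show ?thesis
      by (simp add: sum_subtractf sum_distrib_right)
  qed
  also have "(\<Sum>f\<in>\<Phi>. \<Sum>g\<in>\<Phi>. q f * q g) = 1"
    using q(2) by (simp flip: sum_product)
  finally have "(\<Sum>f\<in>\<Phi>. (q f)\<^sup>2) * card P - \<epsilon> * card P
      \<le> (\<Sum>p\<in>P. (norm (\<Sum>f\<in>\<Phi>. of_real (q f) * cis (s f * Y p)))\<^sup>2)"
    by simp
  moreover have "1 / card \<Phi> \<le> (\<Sum>f\<in>\<Phi>. (q f)\<^sup>2)"
    using sum_squared_le_sum_of_squares[of q \<Phi>] q(2) card by (simp add: field_simps)
  then have "1 / card \<Phi> * card P \<le> (\<Sum>f\<in>\<Phi>. (q f)\<^sup>2) * card P"
    by (intro mult_right_mono) auto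
  ultimately show ?thesis
    by (simp add: left_diff_distrib)
qed

lemma prod_half_one_plus_cis_power:
  fixes c :: "'j \<Rightarrow> real"
  assumes "finite J"
  shows "(\<Prod>j\<in>J. ((1 + cis (c j * y)) / 2) ^ r)
    = (\<Sum>f\<in>PiE J (\<lambda>_. {..r}). of_real (\<Prod>j\<in>J. real (r choose f j) / 2 ^ r) * cis ((\<Sum>j\<in>J. real (f j) * c j) * y))"
proof -
  have "((1 + cis (c j * y)) / 2) ^ r
      = (\<Sum>k\<le>r. of_real (real (r choose k) / 2 ^ r) * cis (real k * c j * y))" for j
  proof -
    have "(cis (c j * y) + 1) ^ r = (\<Sum>k\<le>r. of_nat (r choose k) * cis (real k * c j * y))"
      by (subst binomial_ring) (simp add: Complex.DeMoivre mult.assoc)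
    then show ?thesis
      by (simp add: power_divide add.commute sum_divide_distrib)
  qed
  then have "(\<Prod>j\<in>J. ((1 + cis (c j * y)) / 2) ^ r)
      = (\<Prod>j\<in>J. \<Sum>k\<le>r. of_real (real (r choose k) / 2 ^ r) * cis (real k * c j * y))"
    by simp
  also have "\<dots> = (\<Sum>f\<in>PiE J (\<lambda>_. {..r}).
      \<Prod>j\<in>J. of_real (real (r choose f j) / 2 ^ r) * cis (real (f j) * c j * y))"
    using assms by (intro prod_sum_PiE) auto
  also have "\<dots> = (\<Sum>f\<in>PiE J (\<lambda>_. {..r}). of_real (\<Prod>j\<in>J. real (r choose f j) / 2 ^ r) * cis ((\<Sum>j\<in>J. real (f j) * c j) * y))"
  proof (intro sum.cong refl)
    fix f
    have "(\<Prod>j\<in>J. cis (real (f j) * c j * y)) = cis ((\<Sum>j\<in>J. real (f j) * c j) * y)"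
      using assms by (induction J rule: finite_induct) (simp_all add: cis_mult algebra_simps)
    then show "(\<Prod>j\<in>J. of_real (real (r choose f j) / 2 ^ r) * cis (real (f j) * c j * y))
      = of_real (\<Prod>j\<in>J. real (r choose f j) / 2 ^ r) * cis ((\<Sum>j\<in>J. real (f j) * c j) * y)"
      by (simp only: prod.distrib of_real_prod)
  qed
  finally show ?thesis .
qed

lemma norm_half_one_plus_squared:
  fixes z :: complex
  assumes "norm z = 1"
  shows "(norm ((1 + z) / 2))\<^sup>2 = 1 - (norm (z - 1))\<^sup>2 / 4"
proof -
  have "(Re z)\<^sup>2 + (Im z)\<^sup>2 = 1"
    using assms by (metis cmod_power2 one_power2)
  then show ?thesis
    by (simp add: norm_divide power_divide cmod_power2) (simp add: power2_eq_square field_simps)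
qed

lemma exponential_beats_polynomial:
  fixes \<kappa> :: real
  assumes "0 \<le> \<kappa>" "\<kappa> < 1"
  obtains r :: nat where "(real r + 1) ^ k * \<kappa> ^ r < 1"
proof -
  \<comment> \<open>A root of \<open>\<kappa>\<close> reduces the power \<open>k\<close> to the limit of \<open>r * \<sigma> ^ r\<close>; the exponent
    \<open>Suc k\<close> is never zero.\<close>
  define \<sigma> where "\<sigma> = root (Suc k) \<kappa>"
  have \<sigma>: "0 \<le> \<sigma>" "\<sigma> < 1" "\<sigma> ^ Suc k = \<kappa>"
    using assms by (simp_all add: \<sigma>_def del: power_Suc)
  then have "(\<lambda>n. real n * \<sigma> ^ n + \<sigma> ^ n) \<longlonglongrightarrow> 0 + 0"
    by (intro tendsto_add powser_times_n_limit_0 LIMSEQ_power_zero) auto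
  then have "eventually (\<lambda>n. real n * \<sigma> ^ n + \<sigma> ^ n < 1) sequentially"
    by (intro order_tendstoD(2)[of _ "0 + 0"]) auto
  then obtain r where r: "(real r + 1) * \<sigma> ^ r < 1"
    by (auto simp: eventually_sequentially algebra_simps)
  have "(real r + 1) ^ k * \<kappa> ^ r \<le> (real r + 1) ^ Suc k * \<kappa> ^ r"
    using assms by (intro mult_right_mono power_increasing) auto
  also have "\<dots> = ((real r + 1) * \<sigma> ^ r) ^ Suc k"
    unfolding \<sigma>(3)[symmetric] power_mult_distrib by (metis power_mult mult.commute)
  also have "\<dots> < 1"
    using power_strict_mono[OF r, of "Suc k"] \<sigma>(1) by simp
  finally show thesis
    by (rule that)
qed

text \<open>
  If a progression avoided the Bohr set, then at each of its points some factor of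
  \<open>Q(y) = \<Prod>\<^sub>j ((1 + cis (c\<^sub>j y)) / 2)\<^sup>r\<close> would be exponentially small in \<open>r\<close>. The mean of
  \<open>|Q|\<^sup>2\<close> is only polynomially small in \<open>r\<close>, because \<open>Q\<close> has \<open>(r + 1) ^ card J\<close> terms.
\<close>
lemma quadratic_returns_to_Bohr_set:
  fixes c :: "'j \<Rightarrow> real"
  assumes "finite J" "\<eta> > 0"
    and gen: "\<And>n :: 'j \<Rightarrow> int. (\<Sum>j\<in>J. of_int (n j) * c j) \<noteq> 0 \<Longrightarrow> nontorsion (\<Sum>j\<in>J. of_int (n j) * c j)"
  obtains m :: nat where "m \<ge> 2"
    "\<And>a b. \<exists>i<m. \<forall>j\<in>J. norm (cis (c j * ((real i)\<^sup>2 + a * real i + b)) - 1) < \<eta>"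
proof -
  \<comment> \<open>A factor \<open>|(1 + z) / 2|\<^sup>2\<close> with \<open>|z| = 1\<close> and \<open>|z - 1| \<ge> \<eta>\<close> is at most \<open>\<kappa>\<close>.\<close>
  define \<kappa> where "\<kappa> = max 0 (1 - \<eta>\<^sup>2 / 4)"
  have \<kappa>: "0 \<le> \<kappa>" "\<kappa> < 1"
    using \<open>\<eta> > 0\<close> by (auto simp: \<kappa>_def)
  then obtain r :: nat where r: "(real r + 1) ^ card J * \<kappa> ^ r < 1"
    using exponential_beats_polynomial by blast
  define \<Phi> where "\<Phi> = PiE J (\<lambda>_. {..r})"
  define s where "s = (\<lambda>f. \<Sum>j\<in>J. real (f j) * c j)"
  define q where "q = (\<lambda>f. \<Prod>j\<in>J. real (r choose f j) / 2 ^ r)"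
  define Q where "Q = (\<lambda>y. \<Prod>j\<in>J. ((1 + cis (c j * y)) / 2) ^ r)"
  have Q: "Q y = (\<Sum>f\<in>\<Phi>. of_real (q f) * cis (s f * y))" for y
    unfolding Q_def \<Phi>_def q_def s_def by (rule prod_half_one_plus_cis_power) fact
  have fin: "finite \<Phi>" "card \<Phi> = (r + 1) ^ card J"
    unfolding \<Phi>_def using assms(1) by (auto intro: finite_PiE simp: card_PiE)
  have q: "q f \<ge> 0" for f
    by (simp add: q_def prod_nonneg)
  have "of_real (\<Sum>f\<in>\<Phi>. q f) = Q 0"
    by (simp add: Q)
  also have "\<dots> = 1"
    by (simp add: Q_def)
  finally have sum_q: "(\<Sum>f\<in>\<Phi>. q f) = 1"
    by (simp only: of_real_eq_1_iff)
  \<comment> \<open>The frequency \<open>0\<close> is left out: coincidences \<open>s f = s g\<close> reflect relations among the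
    \<open>c j\<close> and add to the mean.\<close>
  define L where "L = (\<lambda>(f, g). s f - s g) ` (\<Phi> \<times> \<Phi>) - {0}"
  have "finite L"
    unfolding L_def using fin(1) by auto
  have L: "nontorsion \<theta>" if \<theta>: "\<theta> \<in> L" for \<theta>
  proof -
    obtain f g where "\<theta> = s f - s g"
      using \<theta> by (auto simp: L_def)
    moreover have "\<theta> \<noteq> 0"
      using \<theta> by (simp add: L_def)
    moreover have "s f - s g = (\<Sum>j\<in>J. of_int (int (f j) - int (g j)) * c j)"
      by (simp add: s_def sum_subtractf algebra_simps)
    ultimately show ?thesis
      using gen by metis
  qed
  \<comment> \<open>Half of the gap between the mean and the bound off the Bohr set.\<close>
  define \<epsilon> where "\<epsilon> = (1 / card \<Phi> - \<kappa> ^ r) / 2"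
  have "\<epsilon> > 0"
    using r by (simp add: \<epsilon>_def fin(2) field_simps add.commute)
  obtain M H :: nat where MH: "M > 0" "H > 0"
    and small: "\<And>\<theta> a b. \<theta> \<in> L \<Longrightarrow>
       norm (\<Sum>x<M. \<Sum>y<H. cis (\<theta> * ((real (x + y))\<^sup>2 + a * real (x + y) + b))) \<le> \<epsilon> * (real M * real H)"
    using quadratic_averages_small[OF \<open>finite L\<close> L \<open>\<epsilon> > 0\<close>] by blast
  show thesis
  proof
    show "M + H \<ge> 2"
      using MH by linarith
  next
    fix a b
    define Y where "Y = (\<lambda>i. (real i)\<^sup>2 + a * real i + b)"
    define P where "P = {..<M} \<times> {..<H}"
    have P: "finite P" "real (card P) = real M * real H" "card P > 0"
      using MH by (simp_all add: P_def card_cartesian_product)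
    have "(1 / card \<Phi> - \<epsilon>) * card P
        \<le> (\<Sum>p\<in>P. (norm (\<Sum>f\<in>\<Phi>. of_real (q f) * cis (s f * (case p of (x, y) \<Rightarrow> Y (x + y)))))\<^sup>2)"
    proof (rule mean_square_trig_sum_ge[OF fin(1) P(1) q sum_q])
      fix f g assume "f \<in> \<Phi>" "g \<in> \<Phi>" "s f \<noteq> s g"
      then have "s f - s g \<in> L"
        by (auto simp: L_def)
      from small[OF this, of a b]
      show "norm (\<Sum>p\<in>P. cis ((s f - s g) * (case p of (x, y) \<Rightarrow> Y (x + y)))) \<le> \<epsilon> * card P"
        by (simp add: P(2) Y_def) (simp add: P_def sum.cartesian_product case_prod_unfold)
    qed (use \<open>\<epsilon> > 0\<close> in auto)
    also have "\<dots> = (\<Sum>p\<in>P. (norm (Q (Y (fst p + snd p))))\<^sup>2)"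
      by (simp add: Q case_prod_unfold)
    finally have mean: "(1 / card \<Phi> - \<epsilon>) * card P \<le> (\<Sum>p\<in>P. (norm (Q (Y (fst p + snd p))))\<^sup>2)" .
    show "\<exists>i<M + H. \<forall>j\<in>J. norm (cis (c j * ((real i)\<^sup>2 + a * real i + b)) - 1) < \<eta>"
    proof (rule ccontr)
      assume no: "\<not> ?thesis"
      have "(norm (Q (Y i)))\<^sup>2 \<le> \<kappa> ^ r" if "i < M + H" for i
      proof -
        obtain k where k: "k \<in> J" "norm (cis (c k * Y i) - 1) \<ge> \<eta>"
          using no \<open>i < M + H\<close> unfolding Y_def by (meson not_less)
        define v where "v = (\<lambda>j. (norm ((1 + cis (c j * Y i)) / 2))\<^sup>2)"
        have v1: "0 \<le> v j" "v j \<le> 1" for j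
          using norm_triangle_ineq[of 1 "cis (c j * Y i)"] by (auto simp: v_def intro!: power_le_one)
        have "\<eta>\<^sup>2 \<le> (norm (cis (c k * Y i) - 1))\<^sup>2"
          using k \<open>\<eta> > 0\<close> by (intro power_mono) auto
        then have vk: "v k \<le> \<kappa>"
          by (simp add: v_def \<kappa>_def norm_half_one_plus_squared del: norm_divide_numeral)
        have "(norm (Q (Y i)))\<^sup>2 = (\<Prod>j\<in>J. v j) ^ r"
          by (simp add: Q_def v_def prod_norm[symmetric] norm_power prod_power_distrib
                power_mult[symmetric] mult.commute del: norm_divide_numeral)
        also have "(\<Prod>j\<in>J. v j) = v k * (\<Prod>j\<in>J - {k}. v j)"
          using k assms(1) by (simp add: prod.remove)
        also have "(v k * (\<Prod>j\<in>J - {k}. v j)) ^ r \<le> (\<kappa> * 1) ^ r"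
          using v1 vk \<kappa> by (intro power_mono mult_mono prod_le_1 mult_nonneg_nonneg prod_nonneg) auto
        finally show ?thesis by simp
      qed
      then have "(\<Sum>p\<in>P. (norm (Q (Y (fst p + snd p))))\<^sup>2) \<le> (\<Sum>p\<in>P. \<kappa> ^ r)"
        by (intro sum_mono) (auto simp: P_def)
      also have "\<dots> = \<kappa> ^ r * card P"
        by simp
      also have "\<dots> < (1 / card \<Phi> - \<epsilon>) * card P"
      proof (rule mult_strict_right_mono)
        show "\<kappa> ^ r < 1 / card \<Phi> - \<epsilon>"
          using \<open>\<epsilon> > 0\<close> unfolding \<epsilon>_def by (simp add: field_simps)
      qed (use P in simp)
      finally show False
        using mean by simp
    qed
  qed
qed

section \<open>The colouring\<close>

lemma copy_ell_contains_quadratic_values: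
  assumes "is_copy 1 (ell m) n Y" "m \<ge> 2"
  obtains a b where "\<And>i. i < m \<Longrightarrow> \<exists>y\<in>Y. sqnorm n y = (real i)\<^sup>2 + a * real i + b"
proof -
  define e where "e = (\<lambda>i j. if j = (0::nat) then real i else 0)"
  have e: "e i \<in> ell m" if "i < m" for i
    using that by (auto simp: ell_def e_def)
  obtain f where f: "f ` ell m = Y" "\<forall>x\<in>ell m. \<forall>y\<in>ell m. edist n (f x) (f y) = edist 1 x y"
    using assms(1) by (auto simp: is_copy_def)
  have "edist n (f (e i)) (f (e j)) = \<bar>real i - real j\<bar>" if "i < m" "j < m" for i j
    using f(2) e that by (simp add: edist_def L2_set_def e_def)
  then obtain a b where "\<And>i. i < m \<Longrightarrow> sqnorm n (f (e i)) = (real i)\<^sup>2 + a * real i + b"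
    using sqnorm_unit_progression[of m n "\<lambda>i. f (e i)"] \<open>m \<ge> 2\<close> by blast
  then show thesis
    using that f(1) e by (metis imageI)
qed

theorem theorem1:
  fixes d :: nat and X :: "(nat \<Rightarrow> real) set"
  assumes "X \<subseteq> E d" and "finite X" and "\<not> spherical d X"
  shows "\<exists>m. \<forall>n. \<not> arrows n d X 1 (ell m)"
proof -
  obtain c where c: "(\<Sum>x\<in>X. c x) = 0" "\<And>i. i < d \<Longrightarrow> (\<Sum>x\<in>X. c x * x i) = 0"
    "(\<Sum>x\<in>X. c x * sqnorm d x) \<noteq> 0"
    using obtain_dependency_if_not_spherical[OF assms] by blast
  define b where "b = (\<Sum>x\<in>X. c x * sqnorm d x)"
  have "X \<noteq> {}" "b \<noteq> 0"
    using c(3) by (auto simp: b_def)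
  obtain t where t: "nontorsion (t * b)"
    "\<And>n :: (nat \<Rightarrow> real) \<Rightarrow> int. (\<Sum>x\<in>X. of_int (n x) * (t * c x)) \<noteq> 0 \<Longrightarrow>
       nontorsion (\<Sum>x\<in>X. of_int (n x) * (t * c x))"
    using generic_dilation_of_integer_combinations[OF \<open>finite X\<close> \<open>b \<noteq> 0\<close>] by blast
  \<comment> \<open>Then \<open>card X\<close> errors smaller than \<open>\<eta>\<close> cannot add up to the distance of \<open>cis (t * b)\<close>
    from \<open>1\<close>.\<close>
  define \<eta> where "\<eta> = norm (cis (t * b) - 1) / card X"
  have "cis (t * b) \<noteq> 1"
    using t(1)[unfolded nontorsion_def, rule_format, of 1] by simp
  then have "\<eta> > 0"
    using \<open>X \<noteq> {}\<close> \<open>finite X\<close> by (simp add: \<eta>_def card_gt_0_iff)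
  obtain m where m: "m \<ge> 2"
    "\<And>\<alpha> \<beta>. \<exists>i<m. \<forall>x\<in>X. norm (cis (t * c x * ((real i)\<^sup>2 + \<alpha> * real i + \<beta>)) - 1) < \<eta>"
    using quadratic_returns_to_Bohr_set[OF \<open>finite X\<close> \<open>\<eta> > 0\<close> t(2)] by blast
  show ?thesis
  proof (intro exI[of _ m] allI notI)
    fix n assume arr: "arrows n d X 1 (ell m)"
    \<comment> \<open>Only the colouring depends on \<open>n\<close>, through the squared norm; \<open>c\<close>, \<open>t\<close>, \<open>\<eta>\<close> and
      \<open>m\<close> are already fixed.\<close>
    define red where "red = (\<lambda>y. \<forall>x\<in>X. norm (cis (t * c x * sqnorm n y) - 1) < \<eta>)"
    define col where "col = (\<lambda>y. if red y then Red else Blue)"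
    from arr consider Y where "is_copy d X n Y" "\<forall>y\<in>Y. col y = Red"
      | Y where "is_copy 1 (ell m) n Y" "\<forall>y\<in>Y. col y = Blue"
      unfolding arrows_def by blast
    then show False
    proof cases
      case (1 Y)
      then obtain f where f: "f ` X = Y" "\<forall>x\<in>X. \<forall>y\<in>X. edist n (f x) (f y) = edist d x y"
        by (auto simp: is_copy_def)
      have red: "red (f x)" if "x \<in> X" for x
        using 1(2) f(1) that unfolding col_def by (metis imageI colour.distinct(1))
      have "(\<Sum>x\<in>X. t * c x * sqnorm n (f x)) = t * b"
        using dependency_isometry_invariant[OF c(1,2), where n = n and f = f] f(2)
        by (simp add: b_def mult.assoc flip: sum_distrib_left)
      moreover have "(\<Prod>x\<in>X. cis (u x)) = cis (\<Sum>x\<in>X. u x)" for u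
        using \<open>finite X\<close> by (induction X rule: finite_induct) (simp_all add: cis_mult)
      ultimately have "cis (t * b) = (\<Prod>x\<in>X. cis (t * c x * sqnorm n (f x)))"
        by simp
      then have "norm (cis (t * b) - 1) \<le> (\<Sum>x\<in>X. norm (cis (t * c x * sqnorm n (f x)) - 1))"
        using norm_prod_diff[of X "\<lambda>x. cis (t * c x * sqnorm n (f x))" "\<lambda>_. 1"] by simp
      also have "\<dots> < (\<Sum>x\<in>X. \<eta>)"
        using red \<open>finite X\<close> \<open>X \<noteq> {}\<close> by (intro sum_strict_mono) (auto simp: red_def)
      also have "\<dots> = norm (cis (t * b) - 1)"
        using \<open>finite X\<close> \<open>X \<noteq> {}\<close> by (simp add: \<eta>_def)
      finally show False by simp
    next
      case (2 Y)
      then obtain \<alpha> \<beta> where q: "\<And>i. i < m \<Longrightarrow> \<exists>y\<in>Y. sqnorm n y = (real i)\<^sup>2 + \<alpha> * real i + \<beta>"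
        using copy_ell_contains_quadratic_values m(1) by blast
      obtain i where i: "i < m" "\<forall>x\<in>X. norm (cis (t * c x * ((real i)\<^sup>2 + \<alpha> * real i + \<beta>)) - 1) < \<eta>"
        using m(2) by blast
      obtain y where "y \<in> Y" "sqnorm n y = (real i)\<^sup>2 + \<alpha> * real i + \<beta>"
        using q[OF i(1)] by blast
      then have "red y"
        using i(2) by (simp add: red_def)
      then show False
        using 2(2) \<open>y \<in> Y\<close> by (auto simp: col_def)
    qed
  qed
qed

end
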